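(* The scheme $\mathrm{Iab}_C\varphi\vee\mathrm{Iab}_C\neg\varphi$ is not valid: there exist a finite non-empty set of agents $N$, a coalition $C\subseteq N$, a formula $\varphi$, a coalition model $\mathcal{M}$ over $N$ and a state $s$ with $\mathcal{M},s\not\models\mathrm{Iab}_C\varphi$ and $\mathcal{M},s\not\models\mathrm{Iab}_C\neg\varphi$.
   Context: A coalition is any $C\subseteq N$, $\overline{C}=N\setminus C$. Formulas: $\varphi ::= p \mid \neg\varphi \mid (\varphi\wedge\psi) \mid [C]\varphi \mid \mathrm{Iab}_C\varphi$ over a countable set $\mathrm{Prop}$ of variables. A coalition model is $\mathcal{M}=(S,\{Act_i\}_{i\in N},o,V)$ with $S$ non-empty, each $Act_i$ non-empty, $o:S\times\prod_{i\in N}Act_i\to S$, $V:\mathrm{Prop}\to 2^S$; $Act_C=\prod_{i\in C}Act_i$ ($Act_\emptyset$ contains only the empty profile). $\mathcal{M},s\models[C]\varphi$ iff there is $\sigma_C\in Act_C$ such that for all $\sigma_{\overline{C}}\in Act_{\overline{C}}$, $\mathcal{M},o(s,\sigma_C,\sigma_{\overline{C}})\models\varphi$; $\mathcal{M},s\models\mathrm{Iab}_C\varphi$ iff $\mathcal{M},s\not\models[C]\varphi$; atoms and Boolean connectives as usual. *)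

theory Defs
  imports Main "HOL-Library.FuncSet" "HOL-Library.Countable"
begin

datatype ('p, 'i) fm =
    Atom 'p
  | Neg "('p, 'i) fm"
  | Conj "('p, 'i) fm" "('p, 'i) fm"
  | Can "'i set" "('p, 'i) fm"   \<comment> \<open>the coalition modality, written [C] applied to a formula\<close>
  | Iab "'i set" "('p, 'i) fm"

definition Disj :: "('p, 'i) fm \<Rightarrow> ('p, 'i) fm \<Rightarrow> ('p, 'i) fm" where
  "Disj \<phi> \<psi> = Neg (Conj (Neg \<phi>) (Neg \<psi>))"

text \<open>The datatype allows arbitrary sets of elements of the agent type in the modalities;
  the formulas over the agent set \<open>N\<close> are those in which only coalitions
  \<open>C \<subseteq> N\<close> occur.\<close>

primrec formula_over :: "'i set \<Rightarrow> ('p, 'i) fm \<Rightarrow> bool" where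
  "formula_over N (Atom p) \<longleftrightarrow> True"
| "formula_over N (Neg \<phi>) \<longleftrightarrow> formula_over N \<phi>"
| "formula_over N (Conj \<phi> \<psi>) \<longleftrightarrow> formula_over N \<phi> \<and> formula_over N \<psi>"
| "formula_over N (Can C \<phi>) \<longleftrightarrow> C \<subseteq> N \<and> formula_over N \<phi>"
| "formula_over N (Iab C \<phi>) \<longleftrightarrow> C \<subseteq> N \<and> formula_over N \<phi>"

record ('p, 'i, 's, 'a) cmodel =
  states :: "'s set"
  acts :: "'i \<Rightarrow> 'a set"
  outcome :: "'s \<Rightarrow> ('i \<Rightarrow> 'a) \<Rightarrow> 's"
  val :: "'p \<Rightarrow> 's set"

text \<open>Action profiles of \<open>C\<close> are extensional functions on \<open>C\<close>, so that the
  empty coalition has exactly one profile.\<close>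

definition profiles :: "('p, 'i, 's, 'a) cmodel \<Rightarrow> 'i set \<Rightarrow> ('i \<Rightarrow> 'a) set" where
  "profiles M C = (\<Pi>\<^sub>E i\<in>C. acts M i)"

text \<open>The values of the outcome function outside \<open>states M \<times> profiles M N\<close>, and of
  \<open>acts M\<close> outside \<open>N\<close>, are irrelevant.\<close>

definition coalition_model :: "'i set \<Rightarrow> ('p, 'i, 's, 'a) cmodel \<Rightarrow> bool" where
  "coalition_model N M \<longleftrightarrow>
     states M \<noteq> {} \<and>
     (\<forall>i\<in>N. acts M i \<noteq> {}) \<and>
     (\<forall>s\<in>states M. \<forall>\<sigma>\<in>profiles M N. outcome M s \<sigma> \<in> states M) \<and>
     (\<forall>p. val M p \<subseteq> states M)"

text \<open>The joint profile formed from a profile \<open>\<sigma>\<close> of \<open>C\<close> and a profile \<open>\<tau>\<close> of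
  \<open>N - C\<close>; for \<open>C \<subseteq> N\<close> it is again extensional, on \<open>N\<close>.\<close>

definition join :: "'i set \<Rightarrow> ('i \<Rightarrow> 'a) \<Rightarrow> ('i \<Rightarrow> 'a) \<Rightarrow> ('i \<Rightarrow> 'a)" where
  "join C \<sigma> \<tau> = (\<lambda>i. if i \<in> C then \<sigma> i else \<tau> i)"

primrec sat :: "'i set \<Rightarrow> ('p, 'i, 's, 'a) cmodel \<Rightarrow> 's \<Rightarrow> ('p, 'i) fm \<Rightarrow> bool" where
  "sat N M s (Atom p) \<longleftrightarrow> s \<in> val M p"
| "sat N M s (Neg \<phi>) \<longleftrightarrow> \<not> sat N M s \<phi>"
| "sat N M s (Conj \<phi> \<psi>) \<longleftrightarrow> sat N M s \<phi> \<and> sat N M s \<psi>"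
| "sat N M s (Can C \<phi>) \<longleftrightarrow>
     (\<exists>\<sigma>\<in>profiles M C. \<forall>\<tau>\<in>profiles M (N - C). sat N M (outcome M s (join C \<sigma> \<tau>)) \<phi>)"
| "sat N M s (Iab C \<phi>) \<longleftrightarrow>
     \<not> (\<exists>\<sigma>\<in>profiles M C. \<forall>\<tau>\<in>profiles M (N - C). sat N M (outcome M s (join C \<sigma> \<tau>)) \<phi>)"

lemma sat_Iab_iff_not_Can: "sat N M s (Iab C \<phi>) \<longleftrightarrow> \<not> sat N M s (Can C \<phi>)"
  by simp

end

theory Submission imports Defs begin

text \<open>Inability is the negation of ability, so the disjunction fails wherever one coalition
  can force both a formula and its negation. This is consistent, since the two abilities may be
  witnessed by different actions. Here the agent's action names the next state, so by
  \<open>sat_Can_choice_model\<close> whatever holds at some state can be forced; an atom holds at 1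
  and fails at 0.\<close>

text \<open>A single agent who chooses the next state can enforce an atom as well as its negation.\<close>

definition choice_model :: "('p, nat, nat, nat) cmodel" where
  "choice_model = \<lparr>states = {0, 1}, acts = \<lambda>_. {0, 1}, outcome = \<lambda>_ \<sigma>. \<sigma> 0, val = \<lambda>_. {1}\<rparr>"

lemma coalition_model_choice_model: "coalition_model {0} choice_model"
  by (auto simp: coalition_model_def choice_model_def profiles_def)

text \<open>Playing \<open>a\<close> leads to state \<open>a\<close> from any \<open>s\<close>:
  agent 0 is in the coalition, so \<open>\<tau>\<close> cannot affect the outcome.\<close>

lemma sat_Can_choice_model:
  assumes "a \<in> {0, 1}" and "sat {0} choice_model a \<phi>"
  shows "sat {0} choice_model s (Can {0} \<phi>)"
proof -
  have "(\<lambda>i\<in>{0}. a) \<in> profiles choice_model {0}"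
    using assms(1) by (simp add: profiles_def choice_model_def)
  moreover have "outcome choice_model s (join {0} (\<lambda>i\<in>{0}. a) \<tau>) = a" for \<tau>
    by (simp add: choice_model_def join_def)
  ultimately show ?thesis
    using assms(2) by (metis sat.simps(4))
qed

theorem theorem4p20:
  "\<exists>(N :: nat set) C (\<phi> :: ('p::countable, nat) fm) (M :: ('p, nat, nat, nat) cmodel) s.
     finite N \<and> N \<noteq> {} \<and> C \<subseteq> N \<and> formula_over N \<phi> \<and>
     coalition_model N M \<and> s \<in> states M \<and>
     \<not> sat N M s (Iab C \<phi>) \<and> \<not> sat N M s (Iab C (Neg \<phi>)) \<and>
     \<not> sat N M s (Disj (Iab C \<phi>) (Iab C (Neg \<phi>)))"
proof -
  let ?M = "choice_model :: ('p, nat, nat, nat) cmodel"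
  \<comment> \<open>Any atom serves, because the valuation is the same for all of them.\<close>
  let ?p = "Atom undefined :: ('p, nat) fm"
  have pos: "\<not> sat {0} ?M 0 (Iab {0} ?p)"
    unfolding sat_Iab_iff_not_Can not_not
    \<comment> \<open>Action 1 leads to the only state where the atom holds.\<close>
    by (rule sat_Can_choice_model[of 1]) (simp_all add: choice_model_def)
  have neg: "\<not> sat {0} ?M 0 (Iab {0} (Neg ?p))"
    unfolding sat_Iab_iff_not_Can not_not
    \<comment> \<open>Action 0 leads to a state where the atom fails.\<close>
    by (rule sat_Can_choice_model[of 0]) (simp_all add: choice_model_def)
  have "\<not> sat {0} ?M 0 (Disj (Iab {0} ?p) (Iab {0} (Neg ?p)))"
    using pos neg by (simp only: Disj_def sat.simps(2,3) simp_thms)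
  moreover have "0 \<in> states ?M"
    by (simp add: choice_model_def)
  moreover have "formula_over {0} ?p" "finite {0::nat}" "{0::nat} \<noteq> {}" "{0::nat} \<subseteq> {0}"
    by simp_all
  ultimately show ?thesis
    using pos neg coalition_model_choice_model by blast
qed

end
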